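(* For all finite $\Gamma,\Delta\subseteq\mathrm{Form}$: if $\Gamma\models^V_{\mathcal W}\Delta$, then $\Gamma\vdash_{\mathbf{SF}}\Delta$.
   Context: Formulas: $\mathrm{Var}$ is a countable set of variables; $\mathrm{Form}$ is generated from $\bot$ and $\mathrm{Var}$ by $\land,\lor,\to$; $\neg A$ abbreviates $A\to\bot$. Strict finitistic models: an intuitionistic frame $\langle K,\le\rangle$ is a nonempty partially ordered set; all frames are rooted and tree-like (there is a least element $r$, and for each $k$ the set $\{l: l\le k\}$ is a finite chain). An intuitionistic model $\langle K,\le,v\rangle$ adds $v:\mathrm{Var}\to\mathcal P(K)$ with each $v(p)$ closed upwards. It is a strict finitistic model if (1) the frame is finitely branching; (2) each branch has at most countable length; (3) for each $k\in K$, $\{p\in\mathrm{Var}: k\in v(p)\}$ is finite; (4) for every $p$, if $k\in v(p)$ for some $k$, then for every $l\in K$ there is $l'\ge l$ with $l'\in v(p)$. $\mathcal W$ is the class of all strict finitistic models (finite and infinite). Forcing in $W=\langle K,\le,v\rangle\in\mathcal W$: $k\models_W p$ iff $k\in v(p)$; $k\not\models_W\bot$; $k\models_W A\land B$ iff $k\models_W A$ and $k\models_W B$; $k\models_W A\lor B$ iff $k\models_W A$ or $k\models_W B$; $k\models_W A\to B$ iff for every $k'\ge k$ with $k'\models_W A$ there is $k''\ge k'$ with $k''\models_W B$. For finite $\Gamma,\Delta$, $\Gamma\models^V_W\Delta$ means: for every $k\in K$, if $k\models_W A$ for all $A\in\Gamma$, then $k\models_W B$ for some $B\in\Delta$. $\Gamma\models^V_{\mathcal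 W}\Delta$ means $\Gamma\models^V_W\Delta$ for all $W\in\mathcal W$. Sequent calculus $\mathbf{SF}$: sequents are $\Gamma\vdash\Delta$ with $\Gamma,\Delta$ finite sequences of formulas (finite sets are listed as sequences in any order); $\neg\neg\Gamma$ denotes the result of replacing each member $A$ by $\neg\neg A$. Initial sequents: $\bot\vdash$ and $p\vdash p$ for $p\in\mathrm{Var}$. Structural rules: those of Gentzen's classical calculus $\mathbf{LK}$ (weakening, contraction, exchange on both sides, and cut). Logical rules: ($\land$L) from $A,\Gamma\vdash\Delta$ infer $B\land A,\Gamma\vdash\Delta$; from $A,\Gamma\vdash\Delta$ infer $A\land B,\Gamma\vdash\Delta$. ($\land$R) from $\Gamma\vdash\Delta,A$ and $\Gamma\vdash\Delta,B$ infer $\Gamma\vdash\Delta,A\land B$. ($\lor$L) from $A,\Gamma\vdash\Delta$ and $B,\Gamma\vdash\Delta$ infer $A\lor B,\Gamma\vdash\Delta$. ($\lor$R) from $\Gamma\vdash\Delta,A$ infer $\Gamma\vdash\Delta,A\lor B$; from $\Gamma\vdash\Delta,A$ infer $\Gamma\vdash\Delta,B\lor A$. ($\to$L) from $\Gamma\vdash\Delta,A$ and $B,\Pi\vdash\Sigma$ infer $\Gamma,A\to B,\Pi\vdash\Delta,\neg\neg\Sigma$. ($\to$R) from $\Gamma,A\vdash\neg\neg B,\Delta$ infer $\Gamma\vdash A\to B,\neg\neg\Delta$. $\Gamma\vdash_{\mathbf{SF}}\Delta$ means that $\Gamma\vdash\Delta$ is derivable in $\mathbf{SF}$. *)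

theory Defs
  imports "HOL-Library.Countable_Set"
begin

section \<open>Formulas\<close>

datatype 'v form =
    Bot
  | Var 'v
  | And "'v form" "'v form"
  | Or "'v form" "'v form"
  | Imp "'v form" "'v form"

abbreviation Neg :: "'v form \<Rightarrow> 'v form" where
  "Neg A \<equiv> Imp A Bot"

abbreviation NegNeg :: "'v form \<Rightarrow> 'v form" where
  "NegNeg A \<equiv> Neg (Neg A)"


section \<open>Strict finitistic models\<close>

text \<open>A frame is a carrier \<open>K\<close> with an order \<open>R\<close> on it; \<open>(k, l) \<in> R\<close> reads \<open>k \<le> l\<close>.
  Note that \<open>partial_order_on K R\<close> includes \<open>R \<subseteq> K \<times> K\<close>.\<close>

definition immediate_successors :: "'w rel \<Rightarrow> 'w \<Rightarrow> 'w set" where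
  "immediate_successors R k =
    {l. (k, l) \<in> R \<and> k \<noteq> l \<and> (\<forall>m. (k, m) \<in> R \<and> (m, l) \<in> R \<longrightarrow> m = k \<or> m = l)}"

definition branch :: "'w rel \<Rightarrow> 'w set \<Rightarrow> bool" where
  "branch R C \<longleftrightarrow> C \<in> Chains R \<and> (\<forall>D \<in> Chains R. C \<subseteq> D \<longrightarrow> D = C)"

locale intuitionistic_frame =
  fixes K :: "'w set" and R :: "'w rel"
  assumes partial_order: "partial_order_on K R"
    and rooted: "\<exists>r\<in>K. \<forall>k\<in>K. (r, k) \<in> R"
    and tree_like: "\<And>k. k \<in> K \<Longrightarrow> finite {l. (l, k) \<in> R} \<and> {l. (l, k) \<in> R} \<in> Chains R"

locale intuitionistic_model = intuitionistic_frame K R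
  for K :: "'w set" and R :: "'w rel" +
  fixes v :: "'v \<Rightarrow> 'w set"
  assumes valuation: "v p \<subseteq> K"
    and persistent: "\<lbrakk>k \<in> v p; (k, l) \<in> R\<rbrakk> \<Longrightarrow> l \<in> v p"

locale strict_finitistic_model = intuitionistic_model K R v
  for K :: "'w set" and R :: "'w rel" and v :: "'v \<Rightarrow> 'w set" +
  assumes finitely_branching: "k \<in> K \<Longrightarrow> finite (immediate_successors R k)"
    and countable_branches: "branch R C \<Longrightarrow> countable C"
    and finitely_verified: "k \<in> K \<Longrightarrow> finite {p. k \<in> v p}"
    and prevalent: "\<lbrakk>k \<in> v p; l \<in> K\<rbrakk> \<Longrightarrow> \<exists>l'. (l, l') \<in> R \<and> l' \<in> v p"

primrec forces :: "'w rel \<Rightarrow> ('v \<Rightarrow> 'w set) \<Rightarrow> 'w \<Rightarrow> 'v form \<Rightarrow> bool" where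
  "forces R v k Bot \<longleftrightarrow> False"
| "forces R v k (Var p) \<longleftrightarrow> k \<in> v p"
| "forces R v k (And A B) \<longleftrightarrow> forces R v k A \<and> forces R v k B"
| "forces R v k (Or A B) \<longleftrightarrow> forces R v k A \<or> forces R v k B"
| "forces R v k (Imp A B) \<longleftrightarrow>
    (\<forall>k'. (k, k') \<in> R \<and> forces R v k' A \<longrightarrow> (\<exists>k''. (k', k'') \<in> R \<and> forces R v k'' B))"

definition valid_in_model ::
  "'w set \<Rightarrow> 'w rel \<Rightarrow> ('v \<Rightarrow> 'w set) \<Rightarrow> 'v form set \<Rightarrow> 'v form set \<Rightarrow> bool" where
  "valid_in_model K R v \<Gamma> \<Delta> \<longleftrightarrow>
    (\<forall>k\<in>K. (\<forall>A\<in>\<Gamma>. forces R v k A) \<longrightarrow> (\<exists>B\<in>\<Delta>. forces R v k B))"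

text \<open>A strict finitistic model is countable, being a finitely branching tree in which every node
  has finitely many predecessors. So it is isomorphic to one whose worlds are natural numbers, and
  the class of all models may be taken to be the models over subsets of \<open>nat\<close>; lemma
  \<open>valid_transfer\<close> below confirms that models over other types add nothing.\<close>

definition valid :: "'v form set \<Rightarrow> 'v form set \<Rightarrow> bool" where
  "valid \<Gamma> \<Delta> \<longleftrightarrow>
    (\<forall>(K :: nat set) R v. strict_finitistic_model K R v \<longrightarrow> valid_in_model K R v \<Gamma> \<Delta>)"


section \<open>The sequent calculus\<close>

inductive SF :: "'v form list \<Rightarrow> 'v form list \<Rightarrow> bool" where
  bot: "SF [Bot] []"
| ax: "SF [Var p] [Var p]"
| weakL: "SF \<Gamma> \<Delta> \<Longrightarrow> SF (A # \<Gamma>) \<Delta>"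
| weakR: "SF \<Gamma> \<Delta> \<Longrightarrow> SF \<Gamma> (\<Delta> @ [A])"
| contrL: "SF (A # A # \<Gamma>) \<Delta> \<Longrightarrow> SF (A # \<Gamma>) \<Delta>"
| contrR: "SF \<Gamma> (\<Delta> @ [A, A]) \<Longrightarrow> SF \<Gamma> (\<Delta> @ [A])"
| exchL: "SF (\<Gamma> @ [A, B] @ \<Pi>) \<Delta> \<Longrightarrow> SF (\<Gamma> @ [B, A] @ \<Pi>) \<Delta>"
| exchR: "SF \<Gamma> (\<Delta> @ [A, B] @ \<Sigma>) \<Longrightarrow> SF \<Gamma> (\<Delta> @ [B, A] @ \<Sigma>)"
| cut: "\<lbrakk>SF \<Gamma> (\<Delta> @ [A]); SF (A # \<Pi>) \<Sigma>\<rbrakk> \<Longrightarrow> SF (\<Gamma> @ \<Pi>) (\<Delta> @ \<Sigma>)"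
| andL1: "SF (A # \<Gamma>) \<Delta> \<Longrightarrow> SF (And B A # \<Gamma>) \<Delta>"
| andL2: "SF (A # \<Gamma>) \<Delta> \<Longrightarrow> SF (And A B # \<Gamma>) \<Delta>"
| andR: "\<lbrakk>SF \<Gamma> (\<Delta> @ [A]); SF \<Gamma> (\<Delta> @ [B])\<rbrakk> \<Longrightarrow> SF \<Gamma> (\<Delta> @ [And A B])"
| orL: "\<lbrakk>SF (A # \<Gamma>) \<Delta>; SF (B # \<Gamma>) \<Delta>\<rbrakk> \<Longrightarrow> SF (Or A B # \<Gamma>) \<Delta>"
| orR1: "SF \<Gamma> (\<Delta> @ [A]) \<Longrightarrow> SF \<Gamma> (\<Delta> @ [Or A B])"
| orR2: "SF \<Gamma> (\<Delta> @ [A]) \<Longrightarrow> SF \<Gamma> (\<Delta> @ [Or B A])"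
| impL: "\<lbrakk>SF \<Gamma> (\<Delta> @ [A]); SF (B # \<Pi>) \<Sigma>\<rbrakk>
    \<Longrightarrow> SF (\<Gamma> @ [Imp A B] @ \<Pi>) (\<Delta> @ map NegNeg \<Sigma>)"
| impR: "SF (\<Gamma> @ [A]) (NegNeg B # \<Delta>) \<Longrightarrow> SF \<Gamma> (Imp A B # map NegNeg \<Delta>)"

definition SF_derivable :: "'v form set \<Rightarrow> 'v form set \<Rightarrow> bool" where
  "SF_derivable \<Gamma> \<Delta> \<longleftrightarrow>
    (\<forall>G D. distinct G \<and> set G = \<Gamma> \<and> distinct D \<and> set D = \<Delta> \<longrightarrow> SF G D)"


section \<open>Independence of the type of worlds\<close>

lemma (in intuitionistic_frame) countable_carrier:
  assumes fb: "\<And>k. k \<in> K \<Longrightarrow> finite (immediate_successors R k)"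
  shows "countable K"
proof -
  note po = partial_order_onD[OF partial_order]
  define D where "D k = {l. (l, k) \<in> R}" for k
  define L where "L n = {k \<in> K. card (D k) \<le> n}" for n
  have finD: "finite (D k)" if "k \<in> K" for k using tree_like that by (auto simp: D_def)
  have Dk: "k \<in> D k" if "k \<in> K" for k using po(1) that by (auto simp: D_def refl_on_def)
  have Dless: "card (D l) < card (D k)" if "(l, k) \<in> R" "l \<noteq> k" for l k
  proof (rule psubset_card_mono)
    show "finite (D k)" using finD po(4) that by auto
    show "D l \<subset> D k"
      using Dk[of k] po that unfolding D_def by (auto dest: transD antisymD)
  qed
  obtain r where r: "r \<in> K" "\<And>k. k \<in> K \<Longrightarrow> (r, k) \<in> R" using rooted by blast
  have step: "\<exists>l \<in> K. k \<in> immediate_successors R l \<and> card (D l) < card (D k)"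
    if k: "k \<in> K" "k \<noteq> r" for k
  proof -
    let ?P = "\<lambda>l. (l, k) \<in> R \<and> l \<noteq> k"
    have "?P r" using r k by auto
    moreover have "\<forall>l. ?P l \<longrightarrow> card (D l) < card (D k)" using Dless by blast
    ultimately have "\<exists>l. ?P l \<and> (\<forall>m. ?P m \<longrightarrow> card (D m) \<le> card (D l))"
      by (rule ex_has_greatest_nat)
    then obtain l where l: "?P l" "\<And>m. ?P m \<Longrightarrow> card (D m) \<le> card (D l)" by blast
    have "k \<in> immediate_successors R l"
      unfolding immediate_successors_def
    proof (intro CollectI conjI allI impI)
      fix m assume m: "(l, m) \<in> R \<and> (m, k) \<in> R"
      show "m = l \<or> m = k"
      proof (rule ccontr)
        assume "\<not> (m = l \<or> m = k)"
        then have "card (D l) < card (D m)" "card (D m) \<le> card (D l)" using m Dless l(2) by auto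
        then show False by simp
      qed
    qed (use l in auto)
    then show ?thesis using l(1) Dless po(4) by blast
  qed
  have "finite (L n)" for n
  proof (induction n)
    case 0
    have "L 0 = {}" using finD Dk unfolding L_def by (auto simp: card_eq_0_iff)
    then show ?case by simp
  next
    case (Suc n)
    have "L (Suc n) \<subseteq> insert r (\<Union>l\<in>L n. immediate_successors R l)"
    proof
      fix k assume k: "k \<in> L (Suc n)"
      show "k \<in> insert r (\<Union>l\<in>L n. immediate_successors R l)"
      proof (cases "k = r")
        case False
        then obtain l where "l \<in> K" "k \<in> immediate_successors R l" "card (D l) < card (D k)"
          using step k unfolding L_def by blast
        then show ?thesis using k unfolding L_def by auto
      qed simp
    qed
    moreover have "finite (insert r (\<Union>l\<in>L n. immediate_successors R l))"
      using Suc fb unfolding L_def by auto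
    ultimately show ?case by (rule finite_subset)
  qed
  then have "countable (\<Union>n. L n)" by (simp add: countable_finite)
  moreover have "K = (\<Union>n. L n)" unfolding L_def by auto
  ultimately show ?thesis by simp
qed

lemma valid_transfer:
  fixes K :: "'w set" and v :: "'v \<Rightarrow> 'w set"
  assumes "valid \<Gamma> \<Delta>" and "strict_finitistic_model K R v"
  shows "valid_in_model K R v \<Gamma> \<Delta>"
proof -
  interpret strict_finitistic_model K R v by fact
  note po = partial_order_onD[OF partial_order]
  define f where "f = to_nat_on K"
  have inj: "inj_on f K"
    unfolding f_def by (rule inj_on_to_nat_on[OF countable_carrier]) (rule finitely_branching)
  define R' where "R' = map_prod f f ` R"
  define v' where "v' p = f ` v p" for p
  have R'f: "(f k, f l) \<in> R' \<longleftrightarrow> (k, l) \<in> R" if "k \<in> K" "l \<in> K" for k l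
  proof
    assume "(f k, f l) \<in> R'"
    then obtain a b where ab: "(a, b) \<in> R" "f k = f a" "f l = f b" unfolding R'_def by auto
    then have "a \<in> K" "b \<in> K" using po(4) by auto
    then show "(k, l) \<in> R" using ab that inj by (auto dest: inj_onD)
  qed (force simp: R'_def)
  have R'D: "\<exists>k\<in>K. \<exists>l\<in>K. x = f k \<and> y = f l \<and> (k, l) \<in> R" if "(x, y) \<in> R'" for x y
    using that po(4) unfolding R'_def by auto
  have v'f: "f k \<in> v' p \<longleftrightarrow> k \<in> v p" if "k \<in> K" for k p
    using that valuation[of p] inj unfolding v'_def by (auto simp: inj_on_def)
  have f_eq: "f k = f l \<longleftrightarrow> k = l" if "k \<in> K" "l \<in> K" for k l
    using that inj by (auto simp: inj_on_def)
  have "strict_finitistic_model (f ` K) R' v'"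
  proof
    show "partial_order_on (f ` K) R'"
      unfolding partial_order_on_def preorder_on_def
    proof (intro conjI)
      show "R' \<subseteq> f ` K \<times> f ` K" using po(4) unfolding R'_def by auto
      show "refl_on (f ` K) R'" using po(1) R'f by (auto simp: refl_on_def)
      show "trans R'"
      proof (rule transI)
        fix x y z assume "(x, y) \<in> R'" "(y, z) \<in> R'"
        then show "(x, z) \<in> R'" by (metis R'D R'f po(2) transD)
      qed
      show "antisym R'"
      proof (rule antisymI)
        fix x y assume "(x, y) \<in> R'" "(y, x) \<in> R'"
        then show "x = y" by (metis R'D R'f po(3) antisymD)
      qed
    qed
    show "\<exists>r\<in>f ` K. \<forall>k\<in>f ` K. (r, k) \<in> R'" using rooted R'f by auto
    show "finite {l. (l, k) \<in> R'} \<and> {l. (l, k) \<in> R'} \<in> Chains R'" if "k \<in> f ` K" for k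
    proof -
      obtain k0 where k0: "k = f k0" "k0 \<in> K" using \<open>k \<in> f ` K\<close> by blast
      have eq: "{l. (l, k) \<in> R'} = f ` {l. (l, k0) \<in> R}"
        using k0 R'D R'f po(4) by (auto simp: f_eq) blast
      show ?thesis unfolding eq using tree_like[OF k0(2)] R'f po(4)
        unfolding Chains_def by blast
    qed
    show "v' p \<subseteq> f ` K" for p using valuation[of p] unfolding v'_def by blast
    show "l \<in> v' p" if "k \<in> v' p" "(k, l) \<in> R'" for k l p
      using that persistent R'D v'f by metis
    show "finite (immediate_successors R' k)" if "k \<in> f ` K" for k
    proof -
      obtain k0 where k0: "k = f k0" "k0 \<in> K" using \<open>k \<in> f ` K\<close> by blast
      have "immediate_successors R' k \<subseteq> f ` immediate_successors R k0"
      proof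
        fix x assume x: "x \<in> immediate_successors R' k"
        then obtain l where l: "l \<in> K" "x = f l"
          using R'D unfolding immediate_successors_def by blast
        have "m = k0 \<or> m = l" if "(k0, m) \<in> R" "(m, l) \<in> R" for m
        proof -
          have "m \<in> K" using that po(4) by blast
          then have "f m = k \<or> f m = x"
            using that x k0 l R'f unfolding immediate_successors_def by blast
          then show ?thesis using f_eq \<open>m \<in> K\<close> k0 l by blast
        qed
        then have "l \<in> immediate_successors R k0"
          using x k0 l R'f unfolding immediate_successors_def by auto
        then show "x \<in> f ` immediate_successors R k0" using l by blast
      qed
      then show ?thesis using finitely_branching[OF k0(2)] finite_subset by blast
    qed
    show "finite {p. k \<in> v' p}" if "k \<in> f ` K" for k
      using that finitely_verified v'f by auto
    show "\<exists>l'. (l, l') \<in> R' \<and> l' \<in> v' p" if kl: "k \<in> v' p" "l \<in> f ` K" for k l p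
    proof -
      obtain k0 l0 where "k0 \<in> v p" "l = f l0" "l0 \<in> K" using kl unfolding v'_def by blast
      moreover from this obtain l' where "(l0, l') \<in> R" "l' \<in> v p" using prevalent by blast
      ultimately show ?thesis using R'f v'f po(4) by blast
    qed
  qed auto
  then have "valid_in_model (f ` K) R' v' \<Gamma> \<Delta>" using assms(1) unfolding valid_def by blast
  moreover have "forces R' v' (f k) A \<longleftrightarrow> forces R v k A" if "k \<in> K" for k A
    using that
  proof (induction A arbitrary: k)
    case (Imp A B)
    have K: "l \<in> K" "m \<in> K" if "(l, m) \<in> R" for l m using that po(4) by auto
    have ex: "(\<exists>y. (f k, y) \<in> R' \<and> P y) \<longleftrightarrow> (\<exists>l. (k, l) \<in> R \<and> P (f l))"
      if "k \<in> K" for k P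
    proof
      assume "\<exists>y. (f k, y) \<in> R' \<and> P y"
      then obtain y where y: "(f k, y) \<in> R'" "P y" by blast
      then obtain l where "l \<in> K" "y = f l" using R'D by blast
      then show "\<exists>l. (k, l) \<in> R \<and> P (f l)" using y R'f that by blast
    next
      assume "\<exists>l. (k, l) \<in> R \<and> P (f l)"
      then show "\<exists>y. (f k, y) \<in> R' \<and> P y" using R'f that K(2) by blast
    qed
    have all: "(\<forall>y. (f k, y) \<in> R' \<longrightarrow> P y) \<longleftrightarrow> (\<forall>l. (k, l) \<in> R \<longrightarrow> P (f l))"
      if "k \<in> K" for k P
      using ex[OF that, of "\<lambda>y. \<not> P y"] by blast
    have "forces R' v' (f k) (Imp A B) \<longleftrightarrow> (\<forall>y. (f k, y) \<in> R' \<longrightarrow>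
      (forces R' v' y A \<longrightarrow> (\<exists>z. (y, z) \<in> R' \<and> forces R' v' z B)))"
      by (simp only: forces.simps imp_conjL)
    also have "\<dots> \<longleftrightarrow> (\<forall>l. (k, l) \<in> R \<longrightarrow>
      (forces R' v' (f l) A \<longrightarrow> (\<exists>z. (f l, z) \<in> R' \<and> forces R' v' z B)))"
      by (rule all[OF Imp.prems])
    also have "\<dots> \<longleftrightarrow> (\<forall>l. (k, l) \<in> R \<longrightarrow>
      (forces R v l A \<longrightarrow> (\<exists>m. (l, m) \<in> R \<and> forces R v m B)))"
    proof -
      have "(\<exists>z. (f l, z) \<in> R' \<and> forces R' v' z B) \<longleftrightarrow> (\<exists>m. (l, m) \<in> R \<and> forces R v m B)"
        if "l \<in> K" for l
        unfolding ex[OF that] using Imp.IH(2) K(2) by blast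
      then show ?thesis using Imp.IH(1) K(2) by simp
    qed
    also have "\<dots> \<longleftrightarrow> forces R v k (Imp A B)" by (simp only: forces.simps imp_conjL)
    finally show ?case .
  qed (auto simp: v'f)
  ultimately show ?thesis unfolding valid_in_model_def by auto
qed

end

theory Submission
  imports Defs
begin

text \<open>In a strict finitistic model every formula forced somewhere is forced densely, so an
  implication is forced everywhere or nowhere, and its value is the classical one under the
  valuation that makes exactly the prevalent variables true. Hence two-node models suffice as
  countermodels: the root shows the variables true now, the top those true eventually.
  An underivable sequent is extended by cuts to an underivable pair \<open>(X, Y)\<close> deciding all subformulas
  and their double negations; the root forces \<open>A\<close> iff \<open>A \<in> X\<close>, and the top forces \<open>A\<close>
  iff \<open>NegNeg A \<in> X\<close>.\<close>

section \<open>Structural rules\<close>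

text \<open>Weakening appends \<open>ys\<close> to \<open>xs\<close>; exchange then brings each
  member of \<open>xs\<close> next to a later copy of it, and contraction absorbs it. A predicate
  \<open>P\<close> on lists lets one argument serve both sides of a sequent.\<close>

lemma closed_under_structural_rules:
  assumes weak: "\<And>x xs. P xs \<Longrightarrow> P (x # xs)"
    and contr: "\<And>x xs. P (x # x # xs) \<Longrightarrow> P (x # xs)"
    and exch: "\<And>x y xs ys. P (xs @ [x, y] @ ys) \<Longrightarrow> P (xs @ [y, x] @ ys)"
    and "P xs" and sub: "set xs \<subseteq> set ys"
  shows "P ys"
proof -
  have to_front: "P (x # us @ ws)" if "P (us @ x # ws)" for x us ws
    using that
  proof (induction us arbitrary: ws rule: rev_induct)
    case (snoc u us)
    then show ?case using exch[of us u x ws] by simp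
  qed simp
  have from_front: "P (us @ x # ws)" if "P (x # us @ ws)" for x us ws
    using that
  proof (induction us arbitrary: ws rule: rev_induct)
    case (snoc u us)
    then show ?case using exch[of us x u ws] by simp
  qed simp
  have weaken: "P (us @ ws)" if "P us" for us ws
    using that
  proof (induction ws)
    case (Cons w ws)
    then show ?case by (auto intro!: from_front weak)
  qed simp
  have absorb: "P ws" if "P (us @ ws)" "set us \<subseteq> set ws" for us ws
    using that
  proof (induction us)
    case (Cons u us)
    then obtain as bs where "us @ ws = as @ u # bs"
      by (metis in_set_conv_decomp append.assoc list.set_intros(1) subsetD)
    with Cons.prems(1) have "P (u # u # as @ bs)"
      using to_front[of "u # as" u bs] by simp
    then have "P (us @ ws)"
      using \<open>us @ ws = as @ u # bs\<close> contr from_front by metis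
    then show ?case using Cons by simp
  qed simp
  show ?thesis using absorb weaken \<open>P xs\<close> sub by blast
qed

lemma SF_mono:
  assumes "SF G D" "set G \<subseteq> set G'" "set D \<subseteq> set D'"
  shows "SF G' D'"
proof -
  have "SF G' D"
    by (rule closed_under_structural_rules[where P = "\<lambda>G. SF G D"])
      (use assms in \<open>auto intro: weakL contrL exchL[simplified]\<close>)
  \<comment> \<open>The right-hand rules act at the end of the succedent; reversal moves them to the
    head.\<close>
  have "SF G' (rev (rev D'))"
  proof (rule closed_under_structural_rules[where P = "\<lambda>D. SF G' (rev D)" and xs = "rev D"])
    show "SF G' (rev (xs @ [y, x] @ ys))" if "SF G' (rev (xs @ [x, y] @ ys))" for x y xs ys
      using that exchR[of G' "rev ys" y x "rev xs"] by simp
  qed (use assms \<open>SF G' D\<close> in \<open>auto intro: weakR contrR[simplified]\<close>)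
  then show ?thesis by simp
qed

section \<open>Derivable sequents\<close>

lemma SF_id: "SF [A] [A]"
proof (induction A)
  case Bot
  show ?case using weakR[OF bot, of Bot] by simp
next
  case (Var p)
  show ?case by (rule ax)
next
  case (And A B)
  have "SF [And A B] ([] @ [A])" "SF [And A B] ([] @ [B])"
    using And by (auto intro: andL1 andL2)
  then show ?case using andR by fastforce
next
  case (Or A B)
  have "SF [A] ([] @ [Or A B])" by (rule orR1) (simp add: Or)
  moreover have "SF [B] ([] @ [Or A B])" by (rule orR2) (simp add: Or)
  ultimately show ?case using orL by fastforce
next
  case (Imp A B)
  \<comment> \<open>\<open>impL\<close> yields \<open>NegNeg B\<close> instead of \<open>B\<close>,
    which is just the form that \<open>impR\<close> expects.\<close>
  have "SF ([A] @ [Imp A B] @ []) ([] @ map NegNeg [B])"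
    by (rule impL) (use Imp in auto)
  then have "SF ([Imp A B] @ [A]) (NegNeg B # [])" by (rule SF_mono) auto
  then show ?case using impR by fastforce
qed

text \<open>The right premise of \<open>impL\<close> is \<open>bot\<close>, whose succedent is
  empty, so no formula of \<open>D\<close> acquires a double negation.\<close>

lemma SF_negL:
  assumes "SF G (A # D)"
  shows "SF (Neg A # G) D"
proof -
  have "SF G (D @ [A])" using assms by (rule SF_mono) auto
  then have "SF (G @ [Neg A] @ []) (D @ map NegNeg [])" by (rule impL) (rule bot)
  then show ?thesis by (rule SF_mono) auto
qed

text \<open>\<open>NegNeg Bot\<close> enters by weakening to fit \<open>impR\<close>, which then
  double-negates the side formulas \<open>D\<close>.\<close>

lemma SF_negR:
  assumes "SF (A # G) D"
  shows "SF G (Neg A # map NegNeg D)"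
proof (rule impR)
  show "SF (G @ [A]) (NegNeg Bot # D)" using assms by (rule SF_mono) auto
qed

lemma SF_negneg: "SF (A # G) D \<Longrightarrow> SF (NegNeg A # G) (map NegNeg D)"
  by (intro SF_negL SF_negR)

lemma SF_negneg_intro: "SF [A] [NegNeg A]"
  using SF_negR[OF SF_negL[OF SF_id]] by simp

lemma SF_imp_elim: "SF [A, Imp A B] [NegNeg B]"
proof -
  have "SF ([A] @ [Imp A B] @ []) ([] @ map NegNeg [B])"
    by (rule impL) (simp_all add: SF_id)
  then show ?thesis by simp
qed

text \<open>With \<open>Neg B\<close> on the left the succedent is empty, so
  \<open>SF_negneg\<close> adds nothing there, and \<open>SF_negR\<close> brings back
  \<open>NegNeg B\<close>. As \<open>NegNeg B\<close> is itself an implication, an instance reduces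
  four negations to two.\<close>

lemma SF_imp_stable: "SF [NegNeg (Imp A B)] [Imp A B]"
proof -
  have "SF [NegNeg B, Neg B] []" by (rule SF_negL) (rule SF_id)
  then have "SF ([A, Imp A B] @ [Neg B]) ([] @ [])"
    using SF_imp_elim by (intro cut) auto
  then have "SF [Imp A B, A, Neg B] []" by (rule SF_mono) auto
  from SF_negneg[OF this] have "SF [Neg B, NegNeg (Imp A B), A] []"
    by (rule SF_mono) auto
  from SF_negR[OF this] have "SF ([NegNeg (Imp A B)] @ [A]) (NegNeg B # [])" by simp
  then show ?thesis using impR by fastforce
qed

lemma SF_negneg_imp_elim: "SF [NegNeg A, Imp A B] [NegNeg B]"
proof -
  have "SF [NegNeg A, Imp A B] ([] @ [NegNeg (NegNeg B)])"
    using SF_negneg[OF SF_imp_elim] by simp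
  from cut[OF this SF_imp_stable] show ?thesis by simp
qed

text \<open>The side formula \<open>A\<close> closes the premise of \<open>impR\<close> and comes
  out as \<open>NegNeg A\<close>: a form of excluded middle, which gives implications their
  classical value.\<close>

lemma SF_imp_or_negneg: "SF [] [Imp A B, NegNeg A]"
proof -
  have "SF ([] @ [A]) (NegNeg B # [A])" using SF_id by (rule SF_mono) auto
  from impR[OF this] show ?thesis by simp
qed

lemma SF_imp_intro: "SF [NegNeg B] [Imp A B]"
proof -
  have "SF ([NegNeg B] @ [A]) (NegNeg B # [])" using SF_id by (rule SF_mono) auto
  from impR[OF this] show ?thesis by simp
qed

lemma SF_and_intro: "SF [A, B] [And A B]"
proof -
  have "SF [A, B] ([] @ [A])" "SF [A, B] ([] @ [B])" by (rule SF_mono[OF SF_id]; simp)+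
  from andR[OF this] show ?thesis by simp
qed

lemma SF_and_elim: "SF [And A B] [A]" "SF [And A B] [B]"
  by (auto intro: andL1 andL2 SF_id)

lemma SF_or_intro: "SF [A] [Or A B]" "SF [B] [Or A B]"
  using orR1[of "[A]" "[]" A B] orR2[of "[B]" "[]" B A] by (simp_all add: SF_id)

lemma SF_or_elim: "SF [Or A B] [A, B]"
  by (auto intro!: orL intro: SF_mono[OF SF_id])

text \<open>\<open>SF_negneg\<close> reaches one antecedent formula at a time, so it is applied
  twice; \<open>SF_imp_stable\<close> removes the surplus negations.\<close>

lemma SF_negneg_and_intro: "SF [NegNeg A, NegNeg B] [NegNeg (And A B)]"
proof -
  have "SF [B, NegNeg A] [NegNeg (And A B)]"
    by (rule SF_mono[OF SF_negneg[OF SF_and_intro]]) auto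
  from SF_negneg[OF this] have "SF [NegNeg B, NegNeg A] ([] @ [NegNeg (NegNeg (And A B))])"
    by simp
  from cut[OF this SF_imp_stable] show ?thesis by (rule SF_mono) auto
qed

section \<open>Underivable pairs\<close>

definition derivable :: "'v form set \<Rightarrow> 'v form set \<Rightarrow> bool" where
  "derivable X Y \<longleftrightarrow> (\<exists>G D. set G \<subseteq> X \<and> set D \<subseteq> Y \<and> SF G D)"

lemma derivable_set_iff: "derivable (set G) (set D) \<longleftrightarrow> SF G D"
  unfolding derivable_def using SF_mono by blast

lemma derivable_cut:
  assumes "derivable X (insert A Y)" "derivable (insert A X) Y"
  shows "derivable X Y"
proof -
  obtain G D where GD: "set G \<subseteq> X" "set D \<subseteq> insert A Y" "SF G D"
    using assms(1) unfolding derivable_def by blast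
  obtain G' D' where GD': "set G' \<subseteq> insert A X" "set D' \<subseteq> Y" "SF G' D'"
    using assms(2) unfolding derivable_def by blast
  \<comment> \<open>All copies of \<open>A\<close> are merged into the single one that
    \<open>cut\<close> expects.\<close>
  have "SF G (removeAll A D @ [A])" using GD(3) by (rule SF_mono) auto
  moreover have "SF (A # removeAll A G') D'" using GD'(3) by (rule SF_mono) auto
  ultimately have "SF (G @ removeAll A G') (removeAll A D @ D')" by (rule cut)
  moreover have "set (G @ removeAll A G') \<subseteq> X" "set (removeAll A D @ D') \<subseteq> Y"
    using GD GD' by auto
  ultimately show ?thesis unfolding derivable_def by blast
qed

text \<open>By \<open>derivable_cut\<close>, a formula can always be added to one of the two sides
  without making the pair derivable. The bound on \<open>X'\<close> keeps it finite, as the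
  valuation requires.\<close>

lemma underivable_extension:
  assumes "finite F" "\<not> derivable X Y"
  shows "\<exists>X' Y'. X \<subseteq> X' \<and> X' \<subseteq> X \<union> F \<and> Y \<subseteq> Y' \<and> F \<subseteq> X' \<union> Y' \<and> \<not> derivable X' Y'"
  using assms
proof (induction F arbitrary: X Y)
  case (insert A F)
  have "\<not> derivable (insert A X) Y \<or> \<not> derivable X (insert A Y)"
    using insert.prems derivable_cut by blast
  then show ?case
  proof
    assume "\<not> derivable (insert A X) Y"
    from insert.IH[OF this] obtain X' Y' where
      "insert A X \<subseteq> X'" "X' \<subseteq> insert A X \<union> F" "Y \<subseteq> Y'" "F \<subseteq> X' \<union> Y'" "\<not> derivable X' Y'"
      by blast
    then show ?thesis by (intro exI[of _ X'] exI[of _ Y']) auto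
  next
    assume "\<not> derivable X (insert A Y)"
    from insert.IH[OF this] obtain X' Y' where
      "X \<subseteq> X'" "X' \<subseteq> X \<union> F" "insert A Y \<subseteq> Y'" "F \<subseteq> X' \<union> Y'" "\<not> derivable X' Y'"
      by blast
    then show ?thesis by (intro exI[of _ X'] exI[of _ Y']) auto
  qed
qed blast

primrec subformulas :: "'v form \<Rightarrow> 'v form set" where
  "subformulas Bot = {Bot}"
| "subformulas (Var p) = {Var p}"
| "subformulas (And A B) = insert (And A B) (subformulas A \<union> subformulas B)"
| "subformulas (Or A B) = insert (Or A B) (subformulas A \<union> subformulas B)"
| "subformulas (Imp A B) = insert (Imp A B) (subformulas A \<union> subformulas B)"

lemma finite_subformulas: "finite (subformulas A)"
  by (induction A) auto

lemma subformulas_refl: "A \<in> subformulas A"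
  by (cases A) auto

section \<open>The two-node countermodel\<close>

definition two_chain :: "nat rel" where
  "two_chain = {(0, 0), (0, 1), (1, 1)}"

text \<open>Nesting the tests makes the valuation persistent for every \<open>X\<close>; a variable
  true anywhere holds at the top, hence is prevalent.\<close>

definition two_chain_valuation :: "'v form set \<Rightarrow> 'v \<Rightarrow> nat set" where
  "two_chain_valuation X p =
    (if NegNeg (Var p) \<in> X then if Var p \<in> X then {0, 1} else {1} else {})"

lemma strict_finitistic_two_chain:
  assumes "finite X"
  shows "strict_finitistic_model {0, 1} two_chain (two_chain_valuation X)"
proof
  show "partial_order_on {0, 1} two_chain"
    unfolding two_chain_def partial_order_on_def preorder_on_def
    by (auto simp: refl_on_def intro: transI antisymI)
  show "\<exists>r\<in>{0, 1}. \<forall>k\<in>{0, 1}. (r, k) \<in> two_chain" by (auto simp: two_chain_def)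
  show "finite {l. (l, k) \<in> two_chain} \<and> {l. (l, k) \<in> two_chain} \<in> Chains two_chain" for k
  proof
    show "finite {l. (l, k) \<in> two_chain}"
      by (rule finite_subset[of _ "{0, 1}"]) (auto simp: two_chain_def)
  qed (auto simp: two_chain_def Chains_def)
  show "two_chain_valuation X p \<subseteq> {0, 1}" for p
    by (auto simp: two_chain_valuation_def)
  show "l \<in> two_chain_valuation X p"
    if "k \<in> two_chain_valuation X p" "(k, l) \<in> two_chain" for k l p
    using that by (auto simp: two_chain_def two_chain_valuation_def split: if_splits)
  show "finite (immediate_successors two_chain k)" for k
    by (rule finite_subset[of _ "{0, 1}"]) (auto simp: immediate_successors_def two_chain_def)
  show "countable C" if "branch two_chain C" for C
  proof -
    have "C \<subseteq> {0, 1}"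
    proof
      fix x assume "x \<in> C"
      then have "(x, x) \<in> two_chain" using that unfolding branch_def Chains_def by blast
      then show "x \<in> {0, 1}" by (auto simp: two_chain_def)
    qed
    then show ?thesis
      using finite_subset[of C "{0, 1}"] by (simp add: countable_finite)
  qed
  show "finite {p. k \<in> two_chain_valuation X p}" for k
  proof -
    have "inj (\<lambda>p. NegNeg (Var p))" by (auto simp: inj_on_def)
    then have "finite ((\<lambda>p. NegNeg (Var p)) -` X)" by (rule finite_vimageI[OF assms])
    then show ?thesis
      by (rule rev_finite_subset) (auto simp: two_chain_valuation_def split: if_splits)
  qed
  show "\<exists>l'. (l, l') \<in> two_chain \<and> l' \<in> two_chain_valuation X p"
    if "k \<in> two_chain_valuation X p" "l \<in> {0, 1}" for k l p
    using that by (intro exI[of _ 1]) (auto simp: two_chain_def two_chain_valuation_def split: if_splits)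
qed

text \<open>Root and top share one induction because an implication at the root also looks at the
  top.\<close>

lemma two_chain_truth:
  assumes underiv: "\<not> derivable X Y"
    and decided: "subformulas C \<subseteq> X \<union> Y" "NegNeg ` subformulas C \<subseteq> X \<union> Y"
  shows "(forces two_chain (two_chain_valuation X) 0 C \<longleftrightarrow> C \<in> X) \<and>
    (forces two_chain (two_chain_valuation X) 1 C \<longleftrightarrow> NegNeg C \<in> X)"
  using decided
proof (induction C)
  \<comment> \<open>Otherwise \<open>D\<close> would lie wholly in \<open>Y\<close> and make
    \<open>(X, Y)\<close> derivable.\<close>
  have sound: "\<exists>B\<in>set D. B \<in> X" if "SF G D" "set G \<subseteq> X" "set D \<subseteq> X \<union> Y" for G D
    using underiv that unfolding derivable_def by blast
  have from_0: "(\<exists>l. (0, l) \<in> two_chain \<and> P l) \<longleftrightarrow> P 0 \<or> P 1"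
    and from_1: "(\<exists>l. (1, l) \<in> two_chain \<and> P l) \<longleftrightarrow> P 1" for P
    by (auto simp: two_chain_def)
  have all_0: "(\<forall>l. (0, l) \<in> two_chain \<longrightarrow> P l) \<longleftrightarrow> P 0 \<and> P 1"
    and all_1: "(\<forall>l. (1, l) \<in> two_chain \<longrightarrow> P l) \<longleftrightarrow> P 1" for P
    by (auto simp: two_chain_def)
  have persist: "NegNeg A \<in> X" if "A \<in> X" "NegNeg A \<in> X \<union> Y" for A
    using sound[OF SF_negneg_intro] that by auto
  {
    case Bot
    have "SF [NegNeg Bot] []" using SF_negneg[OF bot] by simp
    then show ?case using sound[OF bot] sound by fastforce
  next
    case (Var p)
    then show ?case using persist[of "Var p"] by (auto simp: two_chain_valuation_def)
  next
    case (And A B)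
    have IH: "forces two_chain (two_chain_valuation X) 0 A \<longleftrightarrow> A \<in> X"
      "forces two_chain (two_chain_valuation X) 1 A \<longleftrightarrow> NegNeg A \<in> X"
      "forces two_chain (two_chain_valuation X) 0 B \<longleftrightarrow> B \<in> X"
      "forces two_chain (two_chain_valuation X) 1 B \<longleftrightarrow> NegNeg B \<in> X"
      using And by auto
    have dec: "A \<in> X \<union> Y" "B \<in> X \<union> Y" "NegNeg A \<in> X \<union> Y" "NegNeg B \<in> X \<union> Y"
      "And A B \<in> X \<union> Y" "NegNeg (And A B) \<in> X \<union> Y"
      using And.prems subformulas_refl[of A] subformulas_refl[of B] by auto
    have "And A B \<in> X \<longleftrightarrow> A \<in> X \<and> B \<in> X"
      using sound[OF SF_and_intro[of A B], simplified] sound[OF SF_and_elim(1)[of A B], simplified]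
        sound[OF SF_and_elim(2)[of A B], simplified] dec[simplified] by blast
    moreover have "NegNeg (And A B) \<in> X \<longleftrightarrow> NegNeg A \<in> X \<and> NegNeg B \<in> X"
      using sound[OF SF_negneg_and_intro[of A B], simplified]
        sound[OF SF_negneg[OF SF_and_elim(1)[of A B]], simplified]
        sound[OF SF_negneg[OF SF_and_elim(2)[of A B]], simplified] dec[simplified] by blast
    ultimately show ?case using IH by simp
  next
    case (Or A B)
    have IH: "forces two_chain (two_chain_valuation X) 0 A \<longleftrightarrow> A \<in> X"
      "forces two_chain (two_chain_valuation X) 1 A \<longleftrightarrow> NegNeg A \<in> X"
      "forces two_chain (two_chain_valuation X) 0 B \<longleftrightarrow> B \<in> X"
      "forces two_chain (two_chain_valuation X) 1 B \<longleftrightarrow> NegNeg B \<in> X"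
      using Or by auto
    have dec: "A \<in> X \<union> Y" "B \<in> X \<union> Y" "NegNeg A \<in> X \<union> Y" "NegNeg B \<in> X \<union> Y"
      "Or A B \<in> X \<union> Y" "NegNeg (Or A B) \<in> X \<union> Y"
      using Or.prems subformulas_refl[of A] subformulas_refl[of B] by auto
    have "Or A B \<in> X \<longleftrightarrow> A \<in> X \<or> B \<in> X"
      using sound[OF SF_or_elim[of A B], simplified] sound[OF SF_or_intro(1)[of A B], simplified]
        sound[OF SF_or_intro(2)[of B A], simplified] dec[simplified] by blast
    \<comment> \<open>\<open>SF_negneg\<close> double-negates both members of the succedent
      \<open>[A, B]\<close> separately, so double negation distributes over the disjunction.\<close>
    moreover have "NegNeg (Or A B) \<in> X \<longleftrightarrow> NegNeg A \<in> X \<or> NegNeg B \<in> X"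
      using sound[OF SF_negneg[OF SF_or_elim[of A B]], simplified]
        sound[OF SF_negneg[OF SF_or_intro(1)[of A B]], simplified]
        sound[OF SF_negneg[OF SF_or_intro(2)[of B A]], simplified] dec[simplified] by blast
    ultimately show ?case using IH by simp
  next
    case (Imp A B)
    have IH: "forces two_chain (two_chain_valuation X) 0 A \<longleftrightarrow> A \<in> X"
      "forces two_chain (two_chain_valuation X) 1 A \<longleftrightarrow> NegNeg A \<in> X"
      "forces two_chain (two_chain_valuation X) 0 B \<longleftrightarrow> B \<in> X"
      "forces two_chain (two_chain_valuation X) 1 B \<longleftrightarrow> NegNeg B \<in> X"
      using Imp by auto
    have dec: "A \<in> X \<union> Y" "B \<in> X \<union> Y" "NegNeg A \<in> X \<union> Y" "NegNeg B \<in> X \<union> Y"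
      "Imp A B \<in> X \<union> Y" "NegNeg (Imp A B) \<in> X \<union> Y"
      using Imp.prems subformulas_refl[of A] subformulas_refl[of B] by auto
    \<comment> \<open>Elimination gives the forward direction; the other two sequents cover an
      antecedent false at the top and a consequent true there.\<close>
    have "Imp A B \<in> X \<longleftrightarrow> (NegNeg A \<in> X \<longrightarrow> NegNeg B \<in> X)"
      using sound[OF SF_negneg_imp_elim[of A B], simplified]
        sound[OF SF_imp_or_negneg[of A B], simplified]
        sound[OF SF_imp_intro[of B A], simplified] dec[simplified] by blast
    moreover have "NegNeg (Imp A B) \<in> X \<longleftrightarrow> Imp A B \<in> X"
      using sound[OF SF_imp_stable[of A B], simplified] persist[of "Imp A B"] dec[simplified] by blast
    \<comment> \<open>By persistence a witness for \<open>B\<close> may be sought at the top alone,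
      and \<open>A\<close> matters only there, so both nodes evaluate the implication at the
      top.\<close>
    ultimately show ?case
      using persist[of A] persist[of B] dec
      unfolding forces.simps imp_conjL from_0 from_1 all_0 all_1 IH by blast
  }
qed

theorem proposition22:
  fixes \<Gamma> \<Delta> :: "'v::countable form set"
  assumes "finite \<Gamma>" and "finite \<Delta>"
    and "valid \<Gamma> \<Delta>"
  shows "SF_derivable \<Gamma> \<Delta>"
proof -
  have "derivable \<Gamma> \<Delta>"
  proof (rule ccontr)
    assume "\<not> derivable \<Gamma> \<Delta>"
    define T where "T = (\<Union>A\<in>\<Gamma> \<union> \<Delta>. subformulas A)"
    have "finite (T \<union> NegNeg ` T)"
      unfolding T_def using assms(1,2) finite_subformulas by blast
    from underivable_extension[OF this \<open>\<not> derivable \<Gamma> \<Delta>\<close>] obtain X Y where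
      XY: "\<Gamma> \<subseteq> X" "X \<subseteq> \<Gamma> \<union> (T \<union> NegNeg ` T)" "\<Delta> \<subseteq> Y" "T \<union> NegNeg ` T \<subseteq> X \<union> Y"
        "\<not> derivable X Y"
      by blast
    have "finite X"
      using XY(2) \<open>finite (T \<union> NegNeg ` T)\<close> assms(1) by (meson finite_UnI finite_subset)
    have root: "forces two_chain (two_chain_valuation X) 0 C \<longleftrightarrow> C \<in> X"
      if "C \<in> \<Gamma> \<union> \<Delta>" for C
    proof -
      have "subformulas C \<subseteq> T" using that unfolding T_def by blast
      then show ?thesis using two_chain_truth[OF XY(5), of C] XY(4) by blast
    qed
    have "valid_in_model {0, 1} two_chain (two_chain_valuation X) \<Gamma> \<Delta>"
      using assms(3) strict_finitistic_two_chain[OF \<open>finite X\<close>] unfolding valid_def by blast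
    then obtain B where "B \<in> \<Delta>" "B \<in> X"
      using root XY(1) unfolding valid_in_model_def by blast
    \<comment> \<open>As a member of \<open>\<Delta>\<close>, \<open>B\<close> also lies in
      \<open>Y\<close>, so the identity sequent applies.\<close>
    then have "derivable X Y"
      using SF_id[of B] XY(3) unfolding derivable_def
      by (intro exI[of _ "[B]"]) auto
    then show False using XY(5) by simp
  qed
  \<comment> \<open>\<open>derivable_set_iff\<close> holds for every listing of the two sets, so it
    covers all orderings at once.\<close>
  then show ?thesis unfolding SF_derivable_def using derivable_set_iff by blast
qed

end
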